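(* Let $M$ and $N$ be matroids on disjoint finite sets $S$ and $T$, and let $N_0=N\oplus U_{0,S}$. If $M^+$ is any extension of $M$ to $S\cup T$ (i.e., a matroid on $S\cup T$ with $M^+|S=M$) with $r(M^+)=r(M)$, then the matroid union $M^+\vee N_0$ is a semidirect sum of $M$ and $N$.
   Context: $U_{0,S}$ is the rank-$0$ matroid on $S$ (all elements loops), so $N_0$ is the matroid on $S\cup T$ obtained from $N$ by adding the elements of $S$ as loops. For matroids $G$ and $H$ on the same set $E$, the matroid union $G\vee H$ is the matroid on $E$ whose independent sets are exactly the sets $I_G\cup I_H$ with $I_G$ independent in $G$ and $I_H$ independent in $H$. A semidirect sum of matroids $M$ on $S$ and $N$ on $T$ ($S\cap T=\emptyset$) is a matroid $K$ on $S\cup T$ with $K|S=M$ and $K/S=N$. *)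

theory Defs
  imports Main
begin

text \<open>
  A matroid is a ground set together with its family of independent sets. Equality of two
  values of type \<open>'a set_system\<close> is thus equality of matroids, ground sets included.
\<close>

datatype 'a set_system = Set_System (ground: "'a set") (indep: "'a set set")

locale matroid =
  fixes M :: "'a set_system"
  assumes finite_ground: "finite (ground M)"
    and indep_subset_ground: "I \<in> indep M \<Longrightarrow> I \<subseteq> ground M"
    and empty_indep: "{} \<in> indep M"
    and indep_subset: "I \<in> indep M \<Longrightarrow> J \<subseteq> I \<Longrightarrow> J \<in> indep M"
    and augment: "I \<in> indep M \<Longrightarrow> J \<in> indep M \<Longrightarrow> card I < card J \<Longrightarrow>
      \<exists>x \<in> J - I. insert x I \<in> indep M"

definition rank :: "'a set_system \<Rightarrow> nat" where
  "rank M = Max (card ` indep M)"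

definition bases :: "'a set_system \<Rightarrow> 'a set set" where
  "bases M = {B \<in> indep M. \<forall>I \<in> indep M. B \<subseteq> I \<longrightarrow> I = B}"

definition restrict :: "'a set_system \<Rightarrow> 'a set \<Rightarrow> 'a set_system" (infixl "\<restriction>\<^sub>m" 75) where
  "M \<restriction>\<^sub>m X = Set_System (ground M \<inter> X) {I \<in> indep M. I \<subseteq> X}"

text \<open>
  In a matroid, whether \<open>I \<union> B\<close> is independent does not depend on the choice of the
  basis \<open>B\<close> of the restriction to \<open>X\<close>.
\<close>

definition contract :: "'a set_system \<Rightarrow> 'a set \<Rightarrow> 'a set_system" (infixl "'/\<^sub>m" 75) where
  "M /\<^sub>m X = Set_System (ground M - X)
     {I. I \<subseteq> ground M - X \<and> (\<exists>B \<in> bases (M \<restriction>\<^sub>m X). I \<union> B \<in> indep M)}"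

definition uniform_matroid :: "nat \<Rightarrow> 'a set \<Rightarrow> 'a set_system" where
  "uniform_matroid r E = Set_System E {I. I \<subseteq> E \<and> finite I \<and> card I \<le> r}"

text \<open>A direct sum only for systems on disjoint ground sets.\<close>

definition direct_sum :: "'a set_system \<Rightarrow> 'a set_system \<Rightarrow> 'a set_system" (infixl "\<oplus>\<^sub>m" 65) where
  "G \<oplus>\<^sub>m H = Set_System (ground G \<union> ground H) {I \<union> J | I J. I \<in> indep G \<and> J \<in> indep H}"

text \<open>
  For systems on the same set \<open>E\<close>; the ground set is then \<open>E\<close> again. The formula agrees
  with that of the direct sum, of which the union is the generalisation to overlapping ground
  sets.
\<close>

definition matroid_union :: "'a set_system \<Rightarrow> 'a set_system \<Rightarrow> 'a set_system" (infixl "\<or>\<^sub>m" 65) where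
  "G \<or>\<^sub>m H = Set_System (ground G \<union> ground H) {I \<union> J | I J. I \<in> indep G \<and> J \<in> indep H}"

definition is_extension :: "'a set_system \<Rightarrow> 'a set \<Rightarrow> 'a set_system \<Rightarrow> bool" where
  "is_extension M E M' \<longleftrightarrow> matroid M' \<and> ground M' = E \<and> ground M \<subseteq> E \<and> M' \<restriction>\<^sub>m ground M = M"

definition semidirect_sum :: "'a set_system \<Rightarrow> 'a set_system \<Rightarrow> 'a set_system \<Rightarrow> bool" where
  "semidirect_sum M N K \<longleftrightarrow>
     matroid M \<and> matroid N \<and> ground M \<inter> ground N = {} \<and>
     matroid K \<and> ground K = ground M \<union> ground N \<and>
     K \<restriction>\<^sub>m ground M = M \<and> K /\<^sub>m ground M = N"

end

theory Submission
  imports Defs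
begin

text \<open>
  In the union \<open>M_plus \<or> N\<^sub>0\<close>, a set \<open>X \<union> Y\<close> with \<open>X\<close> independent in \<open>M_plus\<close> and \<open>Y\<close> independent
  in \<open>N\<close> meets \<open>S\<close> only in \<open>X\<close>, so the restriction to \<open>S\<close> is \<open>M\<close>. If it contains a basis \<open>B\<close> of
  \<open>M\<close>, then \<open>B \<subseteq> X\<close>, and the rank hypothesis forces \<open>X = B\<close>; the rest of the set is thus
  independent in \<open>N\<close>, so the contraction of \<open>S\<close> is \<open>N\<close>.
\<close>

section \<open>Rank and bases of a matroid\<close>

context matroid
begin

lemma finite_indep: "finite (indep M)"
  by (rule finite_subset[of _ "Pow (ground M)"])
    (use indep_subset_ground finite_ground in auto)

lemma finite_indep_set: "I \<in> indep M \<Longrightarrow> finite I"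
  using indep_subset_ground finite_ground finite_subset by blast

lemma card_le_rank: "I \<in> indep M \<Longrightarrow> card I \<le> rank M"
  unfolding rank_def using finite_indep by simp

lemma indep_of_card_rank_in_bases:
  assumes "B \<in> indep M" "card B = rank M"
  shows "B \<in> bases M"
proof -
  have "I = B" if "I \<in> indep M" "B \<subseteq> I" for I
    using that assms(2) card_le_rank finite_indep_set card_seteq by metis
  then show ?thesis
    using assms(1) by (auto simp: bases_def)
qed

lemma bases_nonempty: "bases M \<noteq> {}"
proof -
  have "rank M \<in> card ` indep M"
    unfolding rank_def using finite_indep empty_indep by (intro Max_in) auto
  then show ?thesis
    using indep_of_card_rank_in_bases by fastforce
qed

text \<open>Membership in \<open>bases\<close> means maximality under inclusion; augmentation turns
  this into maximal cardinality, since a larger independent set would supply an element to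
  add.\<close>

lemma card_basis:
  assumes "B \<in> bases M"
  shows "card B = rank M"
proof -
  have B: "B \<in> indep M" and max: "\<And>I. I \<in> indep M \<Longrightarrow> B \<subseteq> I \<Longrightarrow> I = B"
    using assms by (auto simp: bases_def)
  have "card I \<le> card B" if I: "I \<in> indep M" for I
  proof (rule ccontr)
    assume "\<not> card I \<le> card B"
    then obtain x where "x \<in> I - B" "insert x B \<in> indep M"
      using augment[OF B I] by auto
    then show False
      using max[of "insert x B"] by blast
  qed
  then have "rank M \<le> card B"
    unfolding rank_def using finite_indep empty_indep by (subst Max_le_iff) auto
  then show ?thesis
    using card_le_rank[OF B] by simp
qed

end

section \<open>The union of two matroids is a matroid\<close>

lemma indep_matroid_union_iff:
  "X \<in> indep (G \<or>\<^sub>m H) \<longleftrightarrow> (\<exists>I\<in>indep G. \<exists>J\<in>indep H. X = I \<union> J)"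
  by (auto simp: matroid_union_def)

lemma indep_matroid_union_disjoint:
  assumes "matroid H" "X \<in> indep (G \<or>\<^sub>m H)"
  obtains I J where "I \<in> indep G" "J \<in> indep H" "I \<inter> J = {}" "X = I \<union> J"
proof -
  interpret H: matroid H by fact
  obtain I J where "I \<in> indep G" "J \<in> indep H" "X = I \<union> J"
    using assms(2) by (auto simp: indep_matroid_union_iff)
  then show thesis
    using that[of I "J - I"] H.indep_subset[of J "J - I"] by blast
qed

lemma matroid_union_commute: "G \<or>\<^sub>m H = H \<or>\<^sub>m G"
  unfolding matroid_union_def by (auto simp: Un_commute)

text \<open>
  Each step either succeeds or moves an element of \<open>J1 \<inter> I2\<close> from \<open>I2\<close> to \<open>I1\<close>, which lets the
  decomposition of \<open>I1 \<union> I2\<close> agree better with that of \<open>J1 \<union> J2\<close>; this can happen only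
  finitely often.
\<close>

lemma matroid_union_augment_disjoint:
  fixes G H :: "'a set_system"
  assumes "matroid G" "matroid H"
    and "I1 \<in> indep G" "I2 \<in> indep H" "I1 \<inter> I2 = {}"
    and "J1 \<in> indep G" "J2 \<in> indep H" "J1 \<inter> J2 = {}"
    and "card (I1 \<union> I2) < card (J1 \<union> J2)"
  shows "\<exists>x \<in> (J1 \<union> J2) - (I1 \<union> I2). insert x (I1 \<union> I2) \<in> indep (G \<or>\<^sub>m H)"
  using assms
proof (induction "card (I1 \<inter> J2) + card (I2 \<inter> J1)"
    arbitrary: G H I1 I2 J1 J2 rule: less_induct)
  case less
  \<comment> \<open>Stated for arbitrary \<open>P\<close> and \<open>Q\<close> so that it also
    applies with \<open>G\<close> and \<open>H\<close> exchanged; the measure is symmetric under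
    this exchange.\<close>
  have step: "\<exists>x \<in> (A1 \<union> A2) - (B1 \<union> B2). insert x (B1 \<union> B2) \<in> indep (P \<or>\<^sub>m Q)"
    if P: "matroid P" and Q: "matroid Q"
      and B: "B1 \<in> indep P" "B2 \<in> indep Q" "B1 \<inter> B2 = {}"
      and A: "A1 \<in> indep P" "A2 \<in> indep Q" "A1 \<inter> A2 = {}"
      and card_lt: "card (B1 \<union> B2) < card (A1 \<union> A2)" "card B1 < card A1"
      and meas: "card (B1 \<inter> A2) + card (B2 \<inter> A1) = card (I1 \<inter> J2) + card (I2 \<inter> J1)"
    for P Q :: "'a set_system" and A1 A2 B1 B2
  proof -
    interpret P: matroid P by fact
    interpret Q: matroid Q by fact
    obtain t where t: "t \<in> A1 - B1" "insert t B1 \<in> indep P"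
      using P.augment[OF B(1) A(1) card_lt(2)] by blast
    show ?thesis
    proof (cases "t \<in> B2")
      case False
      have "insert t (B1 \<union> B2) \<in> indep (P \<or>\<^sub>m Q)"
        using t(2) B(2) unfolding indep_matroid_union_iff by (metis Un_insert_left)
      then show ?thesis
        using t(1) False by blast
    next
      case True
      \<comment> \<open>Since \<open>t\<close> lies in \<open>A1\<close>, it is not in
        \<open>A2\<close>: adding it to \<open>B1\<close> leaves the first term of the measure
        alone, while removing it from \<open>B2\<close> lowers the second.\<close>
      have "insert t B1 \<inter> A2 = B1 \<inter> A2"
        using t(1) A(3) by blast
      moreover have "card ((B2 - {t}) \<inter> A1) < card (B2 \<inter> A1)"
        using True t(1) Q.finite_indep_set[OF B(2)] by (intro psubset_card_mono) auto
      ultimately have decr: "card (insert t B1 \<inter> A2) + card ((B2 - {t}) \<inter> A1)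
          < card (I1 \<inter> J2) + card (I2 \<inter> J1)"
        using meas by simp
      \<comment> \<open>The move does not change the union, so both the cardinality hypothesis and
        the goal carry over to the induction hypothesis.\<close>
      have moved: "insert t B1 \<union> (B2 - {t}) = B1 \<union> B2"
        using True by blast
      have disj: "insert t B1 \<inter> (B2 - {t}) = {}"
        using B(3) by blast
      have "B2 - {t} \<in> indep Q"
        using Q.indep_subset[OF B(2)] by blast
      from less.hyps[OF decr P Q t(2) this disj A, unfolded moved, OF card_lt(1)]
      show ?thesis .
    qed
  qed
  interpret G: matroid G by fact
  interpret H: matroid H by fact
  \<comment> \<open>As both decompositions are disjoint, a smaller union forces a smaller part on at
    least one side.\<close>
  have "card (I1 \<union> I2) = card I1 + card I2" "card (J1 \<union> J2) = card J1 + card J2"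
    using less.prems G.finite_indep_set H.finite_indep_set by (simp_all add: card_Un_disjoint)
  then consider "card I1 < card J1" | "card I2 < card J2"
    using less.prems(9) by linarith
  then show ?case
  proof cases
    case 1
    then show ?thesis
      using step[of G H I1 I2 J1 J2] less.prems by simp
  next
    case 2
    then show ?thesis
      using step[of H G I2 I1 J2 J1] less.prems matroid_union_commute[of G H]
      by (simp add: Int_commute Un_commute add.commute)
  qed
qed

lemma matroid_matroid_union:
  assumes G: "matroid G" and H: "matroid H"
  shows "matroid (G \<or>\<^sub>m H)"
proof -
  interpret G: matroid G by fact
  interpret H: matroid H by fact
  show ?thesis
  proof
    show "finite (ground (G \<or>\<^sub>m H))"
      using G.finite_ground H.finite_ground by (simp add: matroid_union_def)
    show "I \<subseteq> ground (G \<or>\<^sub>m H)" if "I \<in> indep (G \<or>\<^sub>m H)" for I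
      using that G.indep_subset_ground H.indep_subset_ground
      by (fastforce simp: matroid_union_def)
    show "{} \<in> indep (G \<or>\<^sub>m H)"
      using G.empty_indep H.empty_indep unfolding indep_matroid_union_iff by blast
    show "J \<in> indep (G \<or>\<^sub>m H)" if "I \<in> indep (G \<or>\<^sub>m H)" "J \<subseteq> I" for I J
    proof -
      obtain X Y where XY: "X \<in> indep G" "Y \<in> indep H" "I = X \<union> Y"
        using \<open>I \<in> indep (G \<or>\<^sub>m H)\<close> unfolding indep_matroid_union_iff by blast
      have "X \<inter> J \<in> indep G" "Y \<inter> J \<in> indep H"
        using G.indep_subset[OF XY(1)] H.indep_subset[OF XY(2)] by simp_all
      moreover have "J = (X \<inter> J) \<union> (Y \<inter> J)"
        using XY(3) \<open>J \<subseteq> I\<close> by blast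
      ultimately show ?thesis
        unfolding indep_matroid_union_iff by blast
    qed
    show "\<exists>x \<in> J - I. insert x I \<in> indep (G \<or>\<^sub>m H)"
      if "I \<in> indep (G \<or>\<^sub>m H)" "J \<in> indep (G \<or>\<^sub>m H)" "card I < card J" for I J
    proof -
      obtain I1 I2 where I: "I1 \<in> indep G" "I2 \<in> indep H" "I1 \<inter> I2 = {}" "I = I1 \<union> I2"
        using indep_matroid_union_disjoint[OF H \<open>I \<in> indep (G \<or>\<^sub>m H)\<close>] .
      obtain J1 J2 where J: "J1 \<in> indep G" "J2 \<in> indep H" "J1 \<inter> J2 = {}" "J = J1 \<union> J2"
        using indep_matroid_union_disjoint[OF H \<open>J \<in> indep (G \<or>\<^sub>m H)\<close>] .
      show ?thesis
        using matroid_union_augment_disjoint[OF G H I(1-3) J(1-3)] that(3) I(4) J(4) by simp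
    qed
  qed
qed

section \<open>Adding loops to a matroid\<close>

lemma ground_direct_sum_loops:
  "ground (N \<oplus>\<^sub>m uniform_matroid 0 S) = ground N \<union> S"
  by (simp add: direct_sum_def uniform_matroid_def)

lemma indep_direct_sum_loops:
  "indep (N \<oplus>\<^sub>m uniform_matroid 0 S) = indep N"
proof -
  have "indep (uniform_matroid 0 S) = {{}}"
    by (auto simp: uniform_matroid_def)
  then show ?thesis
    by (simp add: direct_sum_def)
qed

lemma matroid_direct_sum_loops:
  assumes "matroid N" "finite S"
  shows "matroid (N \<oplus>\<^sub>m uniform_matroid 0 S)"
proof -
  interpret N: matroid N by fact
  show ?thesis
    unfolding matroid_def ground_direct_sum_loops indep_direct_sum_loops
    using N.finite_ground N.indep_subset_ground N.empty_indep N.indep_subset N.augment assms(2)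
    by (simp add: le_supI1)
qed

theorem theorem2p6:
  fixes M N M_plus :: "'a set_system" and S T :: "'a set"
  assumes "matroid M" and "ground M = S"
    and "matroid N" and "ground N = T"
    and "S \<inter> T = {}"
    and "is_extension M (S \<union> T) M_plus"
    and "rank M_plus = rank M"
  shows "semidirect_sum M N (M_plus \<or>\<^sub>m (N \<oplus>\<^sub>m uniform_matroid 0 S))"
proof -
  interpret M: matroid M by fact
  interpret N: matroid N by fact
  interpret P: matroid M_plus
    using assms(6) by (simp add: is_extension_def)
  have ground_P: "ground M_plus = S \<union> T" and P_restrict: "M_plus \<restriction>\<^sub>m S = M"
    using assms(2,6) by (auto simp: is_extension_def)
  have indep_M: "I \<in> indep M \<longleftrightarrow> I \<in> indep M_plus \<and> I \<subseteq> S" for I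
    unfolding P_restrict[symmetric] restrict_def by simp
  define K where "K = M_plus \<or>\<^sub>m (N \<oplus>\<^sub>m uniform_matroid 0 S)"
  have "matroid K"
    unfolding K_def using M.finite_ground assms(2)
    by (intro matroid_matroid_union P.matroid_axioms matroid_direct_sum_loops assms(3)) simp
  have ground_K: "ground K = S \<union> T"
    using ground_P assms(4) ground_direct_sum_loops[of N S]
    by (auto simp: K_def matroid_union_def)
  have indep_K: "X \<in> indep K \<longleftrightarrow> (\<exists>I\<in>indep M_plus. \<exists>J\<in>indep N. X = I \<union> J)" for X
    unfolding K_def indep_matroid_union_iff indep_direct_sum_loops ..
  have N_subset: "J \<subseteq> T" if "J \<in> indep N" for J
    using N.indep_subset_ground that assms(4) by blast
  have "I \<in> indep K \<and> I \<subseteq> S \<longleftrightarrow> I \<in> indep M" for I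
  proof
    assume I: "I \<in> indep K \<and> I \<subseteq> S"
    then obtain X Y where XY: "X \<in> indep M_plus" "Y \<in> indep N" "I = X \<union> Y"
      unfolding indep_K by blast
    then have "Y = {}"
      using N_subset[OF XY(2)] I assms(5) by blast
    then show "I \<in> indep M"
      using XY I indep_M by simp
  next
    assume "I \<in> indep M"
    then show "I \<in> indep K \<and> I \<subseteq> S"
      unfolding indep_K indep_M using N.empty_indep by blast
  qed
  then have K_restrict: "K \<restriction>\<^sub>m S = M"
    unfolding restrict_def using ground_K assms(2)
    by (auto intro!: set_system.expand)
  \<comment> \<open>This is membership in the contraction of \<open>K\<close> by \<open>S\<close>,
    with the bases of \<open>K \<restriction>\<^sub>m S\<close> already replaced by those of
    \<open>M\<close>.\<close>
  have "I \<subseteq> T \<and> (\<exists>B\<in>bases M. I \<union> B \<in> indep K) \<longleftrightarrow> I \<in> indep N" for I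
  proof
    assume "I \<subseteq> T \<and> (\<exists>B\<in>bases M. I \<union> B \<in> indep K)"
    then obtain B where I: "I \<subseteq> T" and B: "B \<in> bases M" and "I \<union> B \<in> indep K"
      by blast
    then obtain X Y where XY: "X \<in> indep M_plus" "Y \<in> indep N" "I \<union> B = X \<union> Y"
      unfolding indep_K by blast
    have "B \<subseteq> S"
      using B indep_M by (auto simp: bases_def)
    then have "B \<subseteq> X"
      using XY N_subset[OF XY(2)] assms(5) by blast
    \<comment> \<open>Here the rank hypothesis enters: \<open>X\<close> may leave \<open>S\<close>,
      but has at most \<open>rank M_plus = rank M\<close> elements, which is the size of
      \<open>B\<close>.\<close>
    moreover have "card X \<le> card B"
      using P.card_le_rank[OF XY(1)] M.card_basis[OF B] assms(7) by simp
    ultimately have "B = X"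
      using P.finite_indep_set[OF XY(1)] by (metis card_seteq)
    \<comment> \<open>Now \<open>X\<close> lies inside \<open>S\<close>, so the elements of
      \<open>I\<close>, all in \<open>T\<close>, must come from \<open>Y\<close>.\<close>
    then have "I \<subseteq> Y"
      using XY(3) I \<open>B \<subseteq> S\<close> assms(5) by blast
    then show "I \<in> indep N"
      using N.indep_subset XY(2) by blast
  next
    assume I: "I \<in> indep N"
    \<comment> \<open>Any basis of \<open>M\<close> serves: it stays independent in
      \<open>M_plus\<close>, so \<open>I\<close> and \<open>B\<close> are the two parts of an
      independent set of the union.\<close>
    obtain B where B: "B \<in> bases M"
      using M.bases_nonempty by blast
    then have "B \<in> indep M_plus"
      using indep_M by (auto simp: bases_def)
    then have "I \<union> B \<in> indep K"
      using I unfolding indep_K by blast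
    then show "I \<subseteq> T \<and> (\<exists>B\<in>bases M. I \<union> B \<in> indep K)"
      using B N_subset[OF I] by blast
  qed
  moreover have "ground K - S = T"
    using ground_K assms(5) by blast
  ultimately have "K /\<^sub>m S = N"
    unfolding contract_def K_restrict using assms(4) by (auto intro!: set_system.expand)
  then show ?thesis
    unfolding semidirect_sum_def K_def[symmetric]
    using assms \<open>matroid K\<close> ground_K K_restrict by simp
qed

end
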